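(* Consider the following algorithm, with $c_1,c_2$ sufficiently large absolute constants, given $\varepsilon>0$ and oracles $\mathrm{MQ}(f),\mathrm{Samp}(f)$ for $f:\{0,1\}^n\to\{0,1\}$. Phase 1: repeat $c_1/\varepsilon$ times: draw $x,y\sim\mathrm{Samp}(f)$; if $f(x\oplus y)=0$, halt and reject. Phase 2: repeat $c_2$ times: draw $x\sim\mathrm{Samp}(f)$, draw $y$ uniformly at random from $\{y\in\{0,1\}^n:y\preceq x\}$, draw $u\sim\mathrm{Samp}(f)$; if $f(y\oplus u)=0$, halt and reject. Finally, accept. This algorithm is a one-sided non-adaptive $\varepsilon$-relative-error tester for anti-monotone conjunctions over $\{0,1\}^n$, making $O(1/\varepsilon)$ oracle calls.
   Context: An anti-monotone conjunction is a conjunction of negated variables. $y\preceq x$ means $y_i\le x_i$ for all $i$; $\oplus$ is coordinatewise XOR. $\mathrm{MQ}(f)$ returns $f(x)$ on query $x$; $\mathrm{Samp}(f)$ returns an independent uniformly random element of $f^{-1}(1)$. For $f^{-1}(1)\ne\emptyset$, $\mathrm{rel}\text{-}\mathrm{dist}(f,g)=|f^{-1}(1)\triangle g^{-1}(1)|/|f^{-1}(1)|$. An $\varepsilon$-relative-error tester for $\mathcal{C}$ accepts with probability at least $2/3$ if $f\in\mathcal{C}$ and rejects with probability at least $2/3$ if $\mathrm{rel}\text{-}\mathrm{dist}(f,g)\ge\varepsilon$ for all $g\in\mathcal{C}$; one-sided means every $f\in\mathcal{C}$ is accepted with probability $1$. *)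

theory Defs
  imports "HOL-Probability.Probability"
begin

section \<open>Boolean functions on the cube\<close>

text \<open>A function on the \<open>n\<close>-cube is represented by a predicate on all Boolean lists, of which only
  the values on lists of length \<open>n\<close> matter.\<close>

definition cube :: "nat \<Rightarrow> bool list set" where
  "cube n = {x. length x = n}"

definition ones :: "nat \<Rightarrow> (bool list \<Rightarrow> bool) \<Rightarrow> bool list set" where
  "ones n f = {x \<in> cube n. f x}"

definition vxor :: "bool list \<Rightarrow> bool list \<Rightarrow> bool list" (infixl "\<oplus>" 65) where
  "x \<oplus> y = map2 (\<lambda>a b. a \<noteq> b) x y"

definition below :: "bool list \<Rightarrow> bool list \<Rightarrow> bool" (infix "\<preceq>" 50) where
  "y \<preceq> x \<longleftrightarrow> list_all2 (\<le>) y x"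

text \<open>The empty conjunction, i.e. the constant function 1, is included.\<close>

definition antimono_conj :: "nat \<Rightarrow> (bool list \<Rightarrow> bool) set" where
  "antimono_conj n = {f. \<exists>S \<subseteq> {..<n}. \<forall>x \<in> cube n. f x \<longleftrightarrow> (\<forall>i \<in> S. \<not> x ! i)}"

definition rel_dist :: "nat \<Rightarrow> (bool list \<Rightarrow> bool) \<Rightarrow> (bool list \<Rightarrow> bool) \<Rightarrow> real" where
  "rel_dist n f g =
     real (card ((ones n f - ones n g) \<union> (ones n g - ones n f))) / real (card (ones n f))"


section \<open>Randomized algorithms with oracles MQ and Samp\<close>

text \<open>An algorithm is a decision tree: it halts with a verdict (\<open>True\<close> for accept), calls one of its
  oracles, or draws internal randomness, and continues depending on the response.\<close>

datatype oracle_alg =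
    Halt bool
  | MQ "bool list" "bool \<Rightarrow> oracle_alg"
  | Samp "bool list \<Rightarrow> oracle_alg"
  | Draw "bool list pmf" "bool list \<Rightarrow> oracle_alg"

text \<open>The joint distribution of the verdict and the number of oracle calls made (to MQ and Samp
  together). It is meaningful only if \<open>ones n f\<close> is nonempty.\<close>

primrec run :: "nat \<Rightarrow> (bool list \<Rightarrow> bool) \<Rightarrow> oracle_alg \<Rightarrow> (bool \<times> nat) pmf" where
  "run n f (Halt b) = return_pmf (b, 0)"
| "run n f (MQ q k) = map_pmf (apsnd Suc) (run n f (k (f q)))"
| "run n f (Samp k) =
     map_pmf (apsnd Suc) (bind_pmf (pmf_of_set (ones n f)) (\<lambda>x. run n f (k x)))"
| "run n f (Draw D k) = bind_pmf D (\<lambda>x. run n f (k x))"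

definition verdict :: "nat \<Rightarrow> (bool list \<Rightarrow> bool) \<Rightarrow> oracle_alg \<Rightarrow> bool pmf" where
  "verdict n f A = map_pmf fst (run n f A)"

definition rel_error_tester ::
    "nat \<Rightarrow> (bool list \<Rightarrow> bool) set \<Rightarrow> real \<Rightarrow> oracle_alg \<Rightarrow> bool" where
  "rel_error_tester n C \<epsilon> A \<longleftrightarrow>
     (\<forall>f. ones n f \<noteq> {} \<longrightarrow>
        (f \<in> C \<longrightarrow> pmf (verdict n f A) True \<ge> 2 / 3) \<and>
        ((\<forall>g \<in> C. rel_dist n f g \<ge> \<epsilon>) \<longrightarrow> pmf (verdict n f A) False \<ge> 2 / 3))"

definition one_sided :: "nat \<Rightarrow> (bool list \<Rightarrow> bool) set \<Rightarrow> oracle_alg \<Rightarrow> bool" where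
  "one_sided n C A \<longleftrightarrow> (\<forall>f \<in> C. ones n f \<noteq> {} \<longrightarrow> pmf (verdict n f A) True = 1)"

text \<open>Two algorithms are compatible if, as long as neither has halted, they perform the same actions
  (the same queries, calls to Samp and internal draws) whenever they receive the same samples and
  the same internal random values, even if they receive different answers to their MQ queries.
  An algorithm is non-adaptive if it is compatible with itself: answers to MQ queries have no
  influence on its further actions, except that they may make it halt early. So all queries can
  be fixed, once the samples and random values are known, before any of them is answered.\<close>

inductive compatible :: "oracle_alg \<Rightarrow> oracle_alg \<Rightarrow> bool" where
  "compatible (Halt b) A"
| "compatible A (Halt b)"
| "(\<And>a a'. compatible (k a) (k' a')) \<Longrightarrow> compatible (MQ q k) (MQ q k')"
| "(\<And>x. compatible (k x) (k' x)) \<Longrightarrow> compatible (Samp k) (Samp k')"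
| "(\<And>x. compatible (k x) (k' x)) \<Longrightarrow> compatible (Draw D k) (Draw D k')"

definition non_adaptive :: "oracle_alg \<Rightarrow> bool" where
  "non_adaptive A \<longleftrightarrow> compatible A A"


section \<open>The tester for anti-monotone conjunctions\<close>

text \<open>The argument \<open>A\<close> of a round is what is executed if the round does not reject.\<close>

definition phase1_round :: "oracle_alg \<Rightarrow> oracle_alg" where
  "phase1_round A =
     Samp (\<lambda>x. Samp (\<lambda>y. MQ (x \<oplus> y) (\<lambda>b. if b then A else Halt False)))"

definition phase2_round :: "oracle_alg \<Rightarrow> oracle_alg" where
  "phase2_round A =
     Samp (\<lambda>x. Draw (pmf_of_set {y. y \<preceq> x}) (\<lambda>y. Samp (\<lambda>u.
       MQ (y \<oplus> u) (\<lambda>b. if b then A else Halt False))))"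

definition conj_tester :: "real \<Rightarrow> nat \<Rightarrow> real \<Rightarrow> oracle_alg" where
  "conj_tester c1 c2 \<epsilon> =
     (phase1_round ^^ nat \<lceil>c1 / \<epsilon>\<rceil>) ((phase2_round ^^ c2) (Halt True))"

end

(*
  Write F for the set of ones of f. If x + y lies in F for most pairs x, y of F, then the popular
  differences of F form a subgroup H that is close to F, so Phase 1 rejects unless such an H exists.
  Anti-monotone conjunctions are exactly the indicators of the downward closed subgroups. If H is not
  downward closed, then at least half of the x in H have some y below them outside H; as the y below
  x form a group, at least half of them lie outside H. The coset y + H is then disjoint from H, so
  y + u misses F for most u in F, and every round of Phase 2 rejects with constant probability.
  A large accuracy parameter is harmless: the conjunction of all negated variables is at relative
  distance at most 2 from f, so only parameters up to 2 matter, for which Phase 1 has many rounds.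
*)
theory Submission imports Defs begin

section \<open>The cube as a group\<close>

lemma finite_cube [simp]: "finite (cube n)"
proof -
  have "cube n = {x. set x \<subseteq> UNIV \<and> length x = n}" by (auto simp: cube_def)
  then show ?thesis by (simp only: finite_lists_length_eq[OF finite])
qed

lemma finite_ones [simp]: "finite (ones n f)"
  by (rule finite_subset[OF _ finite_cube]) (auto simp: ones_def)

lemma length_vxor [simp]: "length (x \<oplus> y) = min (length x) (length y)"
  by (simp add: vxor_def)

lemma nth_vxor [simp]:
  "i < length x \<Longrightarrow> i < length y \<Longrightarrow> (x \<oplus> y) ! i \<longleftrightarrow> x ! i \<noteq> y ! i"
  by (simp add: vxor_def)

lemma vxor_commute: "x \<oplus> y = y \<oplus> x"
  by (rule nth_equalityI) auto

lemma vxor_assoc: "(x \<oplus> y) \<oplus> z = x \<oplus> (y \<oplus> z)"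
  by (rule nth_equalityI) auto

lemma vxor_left_cancel: "length x = length y \<Longrightarrow> x \<oplus> (x \<oplus> y) = y"
  by (rule nth_equalityI) auto

lemma vxor_right_cancel: "length x = length y \<Longrightarrow> (x \<oplus> y) \<oplus> y = x"
  by (rule nth_equalityI) auto

lemma vxor_in_cube: "x \<in> cube n \<Longrightarrow> y \<in> cube n \<Longrightarrow> x \<oplus> y \<in> cube n"
  by (simp add: cube_def)

lemma inj_on_vxor: "z \<in> cube n \<Longrightarrow> A \<subseteq> cube n \<Longrightarrow> inj_on (\<lambda>x. x \<oplus> z) A"
  by (rule inj_on_inverseI[where g = "\<lambda>x. x \<oplus> z"]) (auto simp: cube_def vxor_right_cancel)

lemma card_vxor_preimage_le:
  assumes "z \<in> cube n" "A \<subseteq> cube n" "finite B"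
  shows "card {x \<in> A. x \<oplus> z \<in> B} \<le> card B"
  by (rule card_inj_on_le[where f = "\<lambda>x. x \<oplus> z"]) (use assms in \<open>auto intro!: inj_on_vxor\<close>)

lemma below_iff_nth: "y \<preceq> x \<longleftrightarrow> length y = length x \<and> (\<forall>i<length x. y ! i \<longrightarrow> x ! i)"
  by (auto simp: below_def list_all2_conv_all_nth)

lemma below_refl: "x \<preceq> x"
  by (simp add: below_iff_nth)

lemma below_subset_cube: "x \<in> cube n \<Longrightarrow> {y. y \<preceq> x} \<subseteq> cube n"
  by (auto simp: below_iff_nth cube_def)

lemma finite_below: "finite {y. y \<preceq> x}"
  using finite_subset[OF below_subset_cube finite_cube, of x "length x"] by (simp add: cube_def)

lemma card_below_pos: "card {y. y \<preceq> x} > 0"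
  using below_refl finite_below by (auto simp: card_gt_0_iff)

section \<open>Subgroups of the cube and their index\<close>

text \<open>Every vector is its own inverse, so closure under addition suffices for a
  subgroup.\<close>

definition xor_subgroup :: "nat \<Rightarrow> bool list set \<Rightarrow> bool" where
  "xor_subgroup n H \<longleftrightarrow>
     H \<subseteq> cube n \<and> replicate n False \<in> H \<and> (\<forall>x\<in>H. \<forall>y\<in>H. x \<oplus> y \<in> H)"

lemma xor_subgroupD:
  assumes "xor_subgroup n H"
  shows "H \<subseteq> cube n" "finite H" "replicate n False \<in> H"
    "\<And>x y. x \<in> H \<Longrightarrow> y \<in> H \<Longrightarrow> x \<oplus> y \<in> H"
  using assms finite_subset[OF _ finite_cube] by (auto simp: xor_subgroup_def)

text \<open>For h in \<open>H - K\<close>, the coset h + K lies in \<open>H\<close>, is disjoint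
  from \<open>K\<close> and has the same size.\<close>

lemma card_proper_xor_subgroup:
  assumes H: "xor_subgroup n H" and K: "xor_subgroup n K" and sub: "K \<subset> H"
  shows "2 * card K \<le> card H"
proof -
  obtain h where h: "h \<in> H" "h \<notin> K" using sub by blast
  note H' = xor_subgroupD[OF H] and K' = xor_subgroupD[OF K]
  have hc: "h \<in> cube n" using h H' by blast
  let ?hK = "(\<lambda>x. x \<oplus> h) ` K"
  have disj: "K \<inter> ?hK = {}"
  proof -
    have False if "k \<in> K" "k \<oplus> h \<in> K" for k
    proof -
      have "k \<oplus> (k \<oplus> h) \<in> K" using that K' by blast
      moreover have "k \<oplus> (k \<oplus> h) = h"
        by (rule vxor_left_cancel) (use that hc K' in \<open>auto simp: cube_def\<close>)
      ultimately show False using h by simp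
    qed
    then show ?thesis by blast
  qed
  have "card ?hK = card K" by (rule card_image) (rule inj_on_vxor[OF hc K'(1)])
  then have "2 * card K = card (K \<union> ?hK)"
    using K'(2) disj by (subst card_Un_disjoint) auto
  also have "\<dots> \<le> card H"
    by (rule card_mono) (use H' h sub in auto)
  finally show ?thesis .
qed

section \<open>Sets that are nearly closed under addition\<close>

text \<open>The proof rests on a gap: the number \<open>m z\<close> of elements that translation by
  z moves out of \<open>F\<close> is, for every z in the cube, either at most 2/5 of
  \<open>card F\<close> or at least a fraction \<open>1 - 10 * \<delta>\<close> of it. As
  \<open>m\<close> is subadditive, the vectors of the lower kind form a subgroup.\<close>

lemma near_xor_subgroup:
  fixes \<delta> :: real
  assumes F: "F \<subseteq> cube n" "F \<noteq> {}"
    and bad: "real (card {(x, y) \<in> F \<times> F. x \<oplus> y \<notin> F}) \<le> \<delta> * (real (card F))\<^sup>2"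
    and \<delta>: "\<delta> < 1 / 50"
  obtains H where "xor_subgroup n H"
    "real (card (F - H)) \<le> 5 * \<delta> * real (card F)" "real (card (H - F)) \<le> 2 * \<delta> * real (card F)"
proof -
  define N where "N = real (card F)"
  define m where "m z = real (card {x \<in> F. x \<oplus> z \<notin> F})" for z
  \<comment> \<open>The bound N/5 is small enough that a sum of four elements of \<open>A\<close>
    still has \<open>m\<close> at most 4N/5, below the threshold of \<open>H\<close>.\<close>
  define A where "A = {z \<in> F. m z \<le> N / 5}"
  \<comment> \<open>The popular differences: z is the sum of more than
    \<open>10 * \<delta> * N\<close> pairs (x, x + z) in F. This is twice the bound on
    \<open>card (F - A)\<close> below.\<close>
  define H where "H = {z \<in> cube n. m z < N - 10 * \<delta> * N}"
  have finF: "finite F" using F finite_subset finite_cube by blast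
  have N: "N > 0" using F finF by (simp add: N_def card_gt_0_iff)
  have hits: "real (card {x \<in> F. x \<oplus> z \<in> F}) = N - m z" for z
  proof -
    have "F = {x \<in> F. x \<oplus> z \<in> F} \<union> {x \<in> F. x \<oplus> z \<notin> F}" by blast
    then have "card F = card {x \<in> F. x \<oplus> z \<in> F} + card {x \<in> F. x \<oplus> z \<notin> F}"
      using finF by (metis (no_types, lifting) card_Un_disjoint disjoint_iff finite_Un mem_Collect_eq)
    then show ?thesis by (simp add: N_def m_def)
  qed
  have m_subadd: "m (a \<oplus> b) \<le> m a + m b" if ab: "a \<in> cube n" "b \<in> cube n" for a b
  proof -
    \<comment> \<open>If x + (a + b) is outside F, then either x + a already is, or x + a is an
      element of F that translation by b moves out.\<close>
    let ?Pre = "{x \<in> F. x \<oplus> a \<in> {x \<in> F. x \<oplus> b \<notin> F}}"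
    have "card {x \<in> F. x \<oplus> (a \<oplus> b) \<notin> F} \<le> card ({x \<in> F. x \<oplus> a \<notin> F} \<union> ?Pre)"
      by (rule card_mono) (use finF in \<open>auto simp: vxor_assoc\<close>)
    also have "\<dots> \<le> card {x \<in> F. x \<oplus> a \<notin> F} + card ?Pre" by (rule card_Un_le)
    also have "card ?Pre \<le> card {x \<in> F. x \<oplus> b \<notin> F}"
      by (rule card_vxor_preimage_le) (use finF F ab in auto)
    finally show ?thesis unfolding m_def by linarith
  qed
  have bad_sum: "(\<Sum>z\<in>F. m z) \<le> \<delta> * N\<^sup>2"
  proof -
    have "{(x, y) \<in> F \<times> F. x \<oplus> y \<notin> F} = (SIGMA z:F. {x \<in> F. x \<oplus> z \<notin> F})"
      by (auto simp: vxor_commute)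
    then show ?thesis using bad finF by (simp add: m_def N_def)
  qed
  \<comment> \<open>Markov's inequality: \<open>m\<close> exceeds N/5 on \<open>F - A\<close>, while
    its sum over F is at most \<open>\<delta> * N\<^sup>2\<close>.\<close>
  have cardFA: "real (card (F - A)) \<le> 5 * \<delta> * N"
  proof -
    have "real (card (F - A)) * (N / 5) = (\<Sum>z\<in>F - A. N / 5)" by simp
    also have "\<dots> \<le> (\<Sum>z\<in>F - A. m z)" by (rule sum_mono) (auto simp: A_def)
    also have "\<dots> \<le> (\<Sum>z\<in>F. m z)" by (rule sum_mono2) (auto simp: finF m_def)
    finally have "real (card (F - A)) * (N / 5) \<le> (5 * \<delta> * N) * (N / 5)"
      using bad_sum by (simp add: power2_eq_square)
    then show ?thesis using N by (simp add: mult_le_cancel_right)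
  qed
  have \<delta>N: "10 * \<delta> * N < N / 5" using \<delta> N by simp
  have "N / 5 < N - 10 * \<delta> * N" using \<delta>N N by linarith
  then have A_sub: "A \<subseteq> H" using F by (fastforce simp only: A_def H_def)
  text \<open>A popular difference is a sum of two very popular elements, hence rather popular itself.\<close>
  have popular: "m z \<le> 2 * N / 5" if z: "z \<in> H" for z
  proof -
    have zc: "z \<in> cube n" using z by (simp add: H_def)
    \<comment> \<open>Otherwise each of the \<open>N - m z\<close> elements x with x + z in F has x
      or x + z in \<open>F - A\<close>, so there are at most \<open>10 * \<delta> * N\<close> of
      them, which contradicts the threshold of \<open>H\<close>.\<close>
    have "\<exists>x\<in>A. x \<oplus> z \<in> A"
    proof (rule ccontr)
      assume "\<not> ?thesis"
      then have "{x \<in> F. x \<oplus> z \<in> F} \<subseteq> (F - A) \<union> {x \<in> F. x \<oplus> z \<in> F - A}" by blast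
      then have "card {x \<in> F. x \<oplus> z \<in> F} \<le> card ((F - A) \<union> {x \<in> F. x \<oplus> z \<in> F - A})"
        by (rule card_mono[rotated]) (use finF in auto)
      also have "\<dots> \<le> card (F - A) + card {x \<in> F. x \<oplus> z \<in> F - A}" by (rule card_Un_le)
      also have "card {x \<in> F. x \<oplus> z \<in> F - A} \<le> card (F - A)"
        by (rule card_vxor_preimage_le) (use finF F zc in auto)
      finally have "N - m z \<le> 2 * real (card (F - A))" using hits[of z] by linarith
      then show False using z cardFA by (simp add: H_def)
    qed
    then obtain x where x: "x \<in> A" "x \<oplus> z \<in> A" by blast
    then have "x \<in> cube n" "x \<oplus> z \<in> cube n" using F by (auto simp: A_def)
    then have "m (x \<oplus> (x \<oplus> z)) \<le> m x + m (x \<oplus> z)" by (rule m_subadd)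
    moreover have "x \<oplus> (x \<oplus> z) = z"
      by (rule vxor_left_cancel) (use zc \<open>x \<in> cube n\<close> in \<open>auto simp: cube_def\<close>)
    ultimately show ?thesis using x by (simp add: A_def)
  qed
  have "xor_subgroup n H"
    unfolding xor_subgroup_def
  proof (intro conjI ballI)
    show "H \<subseteq> cube n" by (auto simp: H_def)
    have "x \<oplus> replicate n False = x" if "x \<in> F" for x
      using that F by (intro nth_equalityI) (auto simp: cube_def)
    then have "{x \<in> F. x \<oplus> replicate n False \<notin> F} = {}" by auto
    then have "m (replicate n False) = 0" by (simp only: m_def card.empty of_nat_0)
    then show "replicate n False \<in> H" using \<delta>N N by (simp add: H_def cube_def)
  next
    fix x y assume xy: "x \<in> H" "y \<in> H"
    then have c: "x \<in> cube n" "y \<in> cube n" by (auto simp: H_def)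
    \<comment> \<open>The bound 4N/5 is below the threshold of \<open>H\<close> because
      \<open>10 * \<delta> < 1 / 5\<close>; this gives closure.\<close>
    have "m (x \<oplus> y) \<le> 2 * N / 5 + 2 * N / 5"
      using m_subadd[OF c] popular[OF xy(1)] popular[OF xy(2)] by linarith
    then show "x \<oplus> y \<in> H" using c \<delta>N by (simp add: H_def vxor_in_cube)
  qed
  moreover have "real (card (F - H)) \<le> 5 * \<delta> * real (card F)"
  proof -
    have "card (F - H) \<le> card (F - A)" by (rule card_mono) (use finF A_sub in auto)
    then show ?thesis using cardFA by (simp add: N_def)
  qed
  moreover have "real (card (H - F)) \<le> 2 * \<delta> * real (card F)"
  proof -
    have finH: "finite H" by (simp add: H_def)
    \<comment> \<open>Double counting: each z in \<open>H - F\<close> has at least 3N/5 elements x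
      of F with x + z in F, and each of them yields a bad pair (x, x + z), whose sum is z. The
      resulting factor 5/3 is finally rounded up to 2.\<close>
    let ?S = "SIGMA z:H - F. {x \<in> F. x \<oplus> z \<in> F}"
    let ?B = "{(x, y) \<in> F \<times> F. x \<oplus> y \<notin> F}"
    have "real (card (H - F)) * (3 * N / 5) = (\<Sum>z\<in>H - F. 3 * N / 5)" by simp
    also have "\<dots> \<le> (\<Sum>z\<in>H - F. N - m z)" by (rule sum_mono) (use popular in force)
    also have "\<dots> = real (card ?S)" using finH finF by (simp add: hits[symmetric])
    also have "card ?S \<le> card ?B"
    proof (rule card_inj_on_le[where f = "\<lambda>(z, x). (x, x \<oplus> z)"])
      have cancel: "x \<oplus> (x \<oplus> z) = z" if "x \<in> F" "z \<in> H" for x z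
        by (rule vxor_left_cancel) (use that F in \<open>auto simp: H_def cube_def\<close>)
      show "inj_on (\<lambda>(z, x). (x, x \<oplus> z)) ?S"
        by (rule inj_on_inverseI[where g = "\<lambda>(x, y). (x \<oplus> y, x)"]) (auto simp: cancel)
      show "(\<lambda>(z, x). (x, x \<oplus> z)) ` ?S \<subseteq> ?B" by (auto simp: cancel)
      show "finite ?B" by (rule finite_subset[of _ "F \<times> F"]) (use finF in auto)
    qed
    finally have le: "real (card (H - F)) * (3 * N / 5) \<le> (5 / 3 * \<delta> * N) * (3 * N / 5)"
      using bad by (simp add: N_def power2_eq_square)
    have "real (card (H - F)) \<le> 5 / 3 * \<delta> * N"
      by (rule mult_right_le_imp_le[OF le]) (use N in simp)
    moreover have "\<delta> * N \<ge> 0"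
      using cardFA of_nat_0_le_iff[where n = "card (F - A)" and 'a = real] by linarith
    ultimately show ?thesis by (simp add: N_def)
  qed
  ultimately show thesis by (rule that)
qed

section \<open>Downward closed subgroups\<close>

lemma xor_subgroup_below:
  assumes "x \<in> cube n"
  shows "xor_subgroup n {y. y \<preceq> x}"
  using assms by (auto simp: xor_subgroup_def below_iff_nth cube_def)

lemma xor_subgroup_Int:
  "xor_subgroup n H \<Longrightarrow> xor_subgroup n K \<Longrightarrow> xor_subgroup n (H \<inter> K)"
  by (auto simp: xor_subgroup_def)

text \<open>This makes the index bound for proper subgroups applicable to the part of
  \<open>H\<close> on which no y below x leaves \<open>H\<close>.\<close>

lemma xor_subgroup_downward_core:
  assumes H: "xor_subgroup n H"
  shows "xor_subgroup n {x \<in> H. \<forall>y. y \<preceq> x \<longrightarrow> y \<in> H}"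
  unfolding xor_subgroup_def
proof (intro conjI ballI)
  note H' = xor_subgroupD[OF H]
  show "{x \<in> H. \<forall>y. y \<preceq> x \<longrightarrow> y \<in> H} \<subseteq> cube n" using H' by blast
  have "y = replicate n False" if "y \<preceq> replicate n False" for y
    using that by (intro nth_equalityI) (auto simp: below_iff_nth)
  then show "replicate n False \<in> {x \<in> H. \<forall>y. y \<preceq> x \<longrightarrow> y \<in> H}" using H' by auto
  fix a b assume ab: "a \<in> {x \<in> H. \<forall>y. y \<preceq> x \<longrightarrow> y \<in> H}" "b \<in> {x \<in> H. \<forall>y. y \<preceq> x \<longrightarrow> y \<in> H}"
  then have len: "length a = n" "length b = n" using H' by (auto simp: cube_def)
  have "y \<in> H" if y: "y \<preceq> a \<oplus> b" for y
  proof -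
    \<comment> \<open>Split y along the support of a. Off that support a + b agrees with b, so the
      second piece is below b.\<close>
    let ?y1 = "map2 (\<and>) y a" and ?y2 = "map2 (\<lambda>u v. u \<and> \<not> v) y a"
    have "length y = n" using y len by (simp add: below_iff_nth)
    then have "?y1 \<preceq> a" "?y2 \<preceq> b" and eq: "y = ?y1 \<oplus> ?y2"
      using y len by (auto simp: below_iff_nth intro: nth_equalityI)
    then have "?y1 \<in> H" "?y2 \<in> H" using ab by blast+
    then show ?thesis using H'(4) eq by metis
  qed
  then show "a \<oplus> b \<in> {x \<in> H. \<forall>y. y \<preceq> x \<longrightarrow> y \<in> H}" using ab H' by blast
qed

text \<open>If some element of \<open>H\<close> is 1 at a coordinate, the unit vector there lies
  below it and so in \<open>H\<close>. Sums of such unit vectors give every vector that vanishes on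
  the remaining coordinates \<open>S\<close>.\<close>

lemma downward_closed_xor_subgroup_antimono_conj:
  assumes H: "xor_subgroup n H" and down: "\<And>x y. x \<in> H \<Longrightarrow> y \<preceq> x \<Longrightarrow> y \<in> H"
  shows "(\<lambda>x. x \<in> H) \<in> antimono_conj n"
proof -
  note H' = xor_subgroupD[OF H]
  define S where "S = {i. i < n \<and> (\<forall>x\<in>H. \<not> x ! i)}"
  have "x \<in> H" if x: "x \<in> cube n" "\<forall>i\<in>S. \<not> x ! i" for x
  proof -
    \<comment> \<open>\<open>p k\<close> is x with all coordinates from k on set to 0; the induction
      adds one unit vector at a time.\<close>
    define p where "p k = map (\<lambda>i. i < k \<and> x ! i) [0..<n]" for k
    have p: "k \<le> n \<Longrightarrow> p k \<in> H" for k
    proof (induction k)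
      case 0
      have "p 0 = replicate n False" by (auto simp: p_def intro: nth_equalityI)
      then show ?case using H' by simp
    next
      case (Suc k)
      then have IH: "p k \<in> H" by simp
      show ?case
      proof (cases "x ! k")
        case True
        then have "k \<notin> S" using x by blast
        then obtain h where h: "h \<in> H" "h ! k" using Suc.prems by (auto simp: S_def)
        let ?e = "map (\<lambda>i. i = k) [0..<n]"
        have "?e \<preceq> h" using h H' by (auto simp: below_iff_nth cube_def)
        then have "p k \<oplus> ?e \<in> H" using H' IH down h by blast
        moreover have "p k \<oplus> ?e = p (Suc k)"
          using True by (intro nth_equalityI) (auto simp: p_def less_Suc_eq)
        ultimately show ?thesis by simp
      next
        case False
        then have "p (Suc k) = p k" by (auto simp: p_def less_Suc_eq)
        then show ?thesis using IH by simp
      qed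
    qed
    have "p n = x" using x by (intro nth_equalityI) (auto simp: p_def cube_def)
    then show ?thesis using p[of n] by simp
  qed
  then have "\<forall>x\<in>cube n. x \<in> H \<longleftrightarrow> (\<forall>i\<in>S. \<not> x ! i)" by (auto simp: S_def)
  moreover have "S \<subseteq> {..<n}" by (auto simp: S_def)
  ultimately show ?thesis unfolding antimono_conj_def by blast
qed

section \<open>Acceptance probabilities\<close>

text \<open>The outcome of one round detached from what follows it: \<open>True\<close> means that
  the round does not reject.\<close>

definition pass1 :: "nat \<Rightarrow> (bool list \<Rightarrow> bool) \<Rightarrow> bool pmf" where
  "pass1 n f =
     bind_pmf (pmf_of_set (ones n f)) (\<lambda>x. bind_pmf (pmf_of_set (ones n f)) (\<lambda>y.
       return_pmf (f (x \<oplus> y))))"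

definition pass2 :: "nat \<Rightarrow> (bool list \<Rightarrow> bool) \<Rightarrow> bool pmf" where
  "pass2 n f =
     bind_pmf (pmf_of_set (ones n f)) (\<lambda>x. bind_pmf (pmf_of_set {y. y \<preceq> x}) (\<lambda>y.
       bind_pmf (pmf_of_set (ones n f)) (\<lambda>u. return_pmf (f (y \<oplus> u)))))"

lemma verdict_simps [simp]:
  "verdict n f (Halt b) = return_pmf b"
  "verdict n f (MQ q h) = verdict n f (h (f q))"
  "verdict n f (Samp k) = bind_pmf (pmf_of_set (ones n f)) (\<lambda>x. verdict n f (k x))"
  "verdict n f (Draw D k) = bind_pmf D (\<lambda>x. verdict n f (k x))"
  by (simp_all add: verdict_def pmf.map_comp o_def map_bind_pmf)

lemma verdict_phase1_round:
  "verdict n f (phase1_round A) =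
     bind_pmf (pass1 n f) (\<lambda>b. if b then verdict n f A else return_pmf False)"
  by (simp add: phase1_round_def pass1_def bind_assoc_pmf bind_return_pmf if_distrib[of "verdict n f"] cong: if_cong)

lemma verdict_phase2_round:
  "verdict n f (phase2_round A) =
     bind_pmf (pass2 n f) (\<lambda>b. if b then verdict n f A else return_pmf False)"
  by (simp add: phase2_round_def pass2_def bind_assoc_pmf bind_return_pmf if_distrib[of "verdict n f"] cong: if_cong)

lemma pmf_bind_if_True:
  "pmf (bind_pmf P (\<lambda>b. if b then Q else return_pmf False)) True = pmf P True * pmf Q True"
proof -
  have "pmf (bind_pmf P (\<lambda>b. if b then Q else return_pmf False)) True =
      (\<Sum>b\<in>UNIV. pmf (if b then Q else return_pmf False) True * pmf P b)"
    unfolding pmf_bind by (subst integral_measure_pmf_real[where A = UNIV]) auto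
  then show ?thesis by (simp add: UNIV_bool)
qed

text \<open>Rounds use independent randomness, and acceptance means that every round passes.\<close>

lemma verdict_conj_tester:
  "pmf (verdict n f (conj_tester c1 c2 \<epsilon>)) True =
     pmf (pass1 n f) True ^ nat \<lceil>c1 / \<epsilon>\<rceil> * pmf (pass2 n f) True ^ c2"
proof -
  have "pmf (verdict n f ((phase1_round ^^ k) A)) True =
      pmf (pass1 n f) True ^ k * pmf (verdict n f A) True" for k A
    by (induction k) (simp_all add: verdict_phase1_round pmf_bind_if_True)
  moreover have "pmf (verdict n f ((phase2_round ^^ k) A)) True =
      pmf (pass2 n f) True ^ k * pmf (verdict n f A) True" for k A
    by (induction k) (simp_all add: verdict_phase2_round pmf_bind_if_True)
  ultimately show ?thesis by (simp add: conj_tester_def)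
qed

text \<open>The ones of a conjunction of negated variables are closed under addition and downward
  closed, so no query is answered 0.\<close>

lemma pass_antimono_conj:
  assumes f: "f \<in> antimono_conj n" and ne: "ones n f \<noteq> {}"
  shows "pass1 n f = return_pmf True" "pass2 n f = return_pmf True"
proof -
  obtain S where S: "S \<subseteq> {..<n}" "\<And>x. x \<in> cube n \<Longrightarrow> f x \<longleftrightarrow> (\<forall>i\<in>S. \<not> x ! i)"
    using f by (auto simp: antimono_conj_def)
  have add: "f (x \<oplus> y)" if "x \<in> ones n f" "y \<in> ones n f" for x y
    using that S by (auto simp: ones_def vxor_in_cube) (auto simp: cube_def subset_iff)
  have down: "y \<in> ones n f" if "x \<in> ones n f" "y \<preceq> x" for x y
    using that S by (auto simp: ones_def below_iff_nth cube_def)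
  have set_below: "set_pmf (pmf_of_set {y. y \<preceq> x}) = {y. y \<preceq> x}" for x
    using below_refl by (intro set_pmf_of_set finite_below) blast
  have "pass1 n f = bind_pmf (pmf_of_set (ones n f)) (\<lambda>x. bind_pmf (pmf_of_set (ones n f)) (\<lambda>y.
       return_pmf True))"
    unfolding pass1_def by (intro bind_pmf_cong refl) (auto simp: ne add)
  then show "pass1 n f = return_pmf True" by simp
  have "pass2 n f = bind_pmf (pmf_of_set (ones n f)) (\<lambda>x. bind_pmf (pmf_of_set {y. y \<preceq> x}) (\<lambda>y.
       bind_pmf (pmf_of_set (ones n f)) (\<lambda>u. return_pmf True)))"
    unfolding pass2_def
    by (intro bind_pmf_cong refl) (auto simp: ne set_below intro: add down)
  then show "pass2 n f = return_pmf True" by simp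
qed

section \<open>Rejection probability of a single round\<close>

text \<open>Identifies the rejection probability with the density of bad pairs, the quantity bounded
  by \<open>\<delta>\<close> in \<open>near_xor_subgroup\<close>.\<close>

lemma pmf_pass1_False:
  assumes ne: "ones n f \<noteq> {}"
  shows "pmf (pass1 n f) False =
    real (card {(x, y) \<in> ones n f \<times> ones n f. x \<oplus> y \<notin> ones n f}) / (real (card (ones n f)))\<^sup>2"
proof -
  let ?F = "ones n f"
  have "pmf (return_pmf (f (x \<oplus> y))) False = of_bool (x \<oplus> y \<notin> ?F)"
    if "x \<in> ?F" "y \<in> ?F" for x y
    using that by (auto simp: ones_def vxor_in_cube)
  then have "pmf (pass1 n f) False =
      (\<Sum>x\<in>?F. \<Sum>y\<in>?F. of_bool (x \<oplus> y \<notin> ?F)) / (real (card ?F))\<^sup>2"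
    unfolding pass1_def using ne
    by (simp add: pmf_bind_pmf_of_set sum_divide_distrib power2_eq_square)
  also have "(\<Sum>x\<in>?F. \<Sum>y\<in>?F. of_bool (x \<oplus> y \<notin> ?F)) =
      (\<Sum>x\<in>?F. real (card {y \<in> ?F. x \<oplus> y \<notin> ?F}))"
    by (simp add: of_bool_def sum.If_cases Int_def)
  also have "\<dots> = real (card (SIGMA x:?F. {y \<in> ?F. x \<oplus> y \<notin> ?F}))" by simp
  also have "(SIGMA x:?F. {y \<in> ?F. x \<oplus> y \<notin> ?F}) = {(x, y) \<in> ?F \<times> ?F. x \<oplus> y \<notin> ?F}" by blast
  finally show ?thesis .
qed

text \<open>Three bounds multiply: x falls into \<open>H - K\<close> with probability at least
  47/100, then y outside \<open>H\<close> with probability at least 1/2, and then y + u misses F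
  with probability at least 24/25.\<close>

lemma pmf_pass2_False:
  assumes H: "xor_subgroup n H" and ne: "ones n f \<noteq> {}"
    and notC: "(\<lambda>x. x \<in> H) \<notin> antimono_conj n"
    and FH: "real (card (ones n f - H)) \<le> real (card (ones n f)) / 50"
    and HF: "real (card (H - ones n f)) \<le> real (card (ones n f)) / 50"
  shows "pmf (pass2 n f) False \<ge> 1 / 5"
proof -
  define F where "F = ones n f"
  define N where "N = real (card F)"
  \<comment> \<open>The largest downward closed subset of \<open>H\<close>; it is proper because
    \<open>H\<close> is not an anti-monotone conjunction.\<close>
  define K where "K = {x \<in> H. \<forall>y. y \<preceq> x \<longrightarrow> y \<in> H}"
  note H' = xor_subgroupD[OF H]
  have F: "F \<subseteq> cube n" "finite F" "F \<noteq> {}" using ne by (auto simp: F_def ones_def)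
  have N: "N > 0" using F by (simp add: N_def card_gt_0_iff)
  \<comment> \<open>\<open>r y\<close> and \<open>s x\<close> are the rejection probabilities of the
    round once y, respectively x, has been drawn.\<close>
  define r where "r y = pmf (bind_pmf (pmf_of_set F) (\<lambda>u. return_pmf (f (y \<oplus> u)))) False" for y
  define s where "s x = pmf (bind_pmf (pmf_of_set {y. y \<preceq> x})
      (\<lambda>y. bind_pmf (pmf_of_set F) (\<lambda>u. return_pmf (f (y \<oplus> u))))) False" for x
  have r: "r y \<ge> 24 / 25" if y: "y \<in> cube n" "y \<notin> H" for y
  proof -
    let ?P = "{u \<in> F. y \<oplus> u \<in> F}"
    \<comment> \<open>If u and y + u were both in \<open>H\<close>, so would be their sum y. Hence
      one of them is among the at most N/50 elements of \<open>F - H\<close>.\<close>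
    have "?P \<subseteq> (F - H) \<union> {u \<in> F. u \<oplus> y \<in> F - H}"
    proof
      fix u assume u: "u \<in> ?P"
      have "(y \<oplus> u) \<oplus> u = y"
        by (rule vxor_right_cancel) (use u y F in \<open>auto simp: cube_def\<close>)
      then have "u \<notin> H \<or> y \<oplus> u \<notin> H" using y H'(4) by metis
      then show "u \<in> (F - H) \<union> {u \<in> F. u \<oplus> y \<in> F - H}" using u by (auto simp: vxor_commute)
    qed
    then have "card ?P \<le> card ((F - H) \<union> {u \<in> F. u \<oplus> y \<in> F - H})"
      by (rule card_mono[rotated]) (use F in auto)
    also have "\<dots> \<le> card (F - H) + card {u \<in> F. u \<oplus> y \<in> F - H}" by (rule card_Un_le)
    also have "card {u \<in> F. u \<oplus> y \<in> F - H} \<le> card (F - H)"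
      by (rule card_vxor_preimage_le) (use F y in auto)
    finally have P: "real (card ?P) \<le> N / 25" using FH by (simp add: F_def N_def)
    have "f (y \<oplus> u) \<longleftrightarrow> y \<oplus> u \<in> F" if "u \<in> F" for u
      using that F y by (auto simp: F_def ones_def vxor_in_cube)
    then have "pmf (return_pmf (f (y \<oplus> u))) False = 1 - of_bool (y \<oplus> u \<in> F)" if "u \<in> F" for u
      using that by auto
    then have "r y = (\<Sum>u\<in>F. 1 - of_bool (y \<oplus> u \<in> F)) / N"
      unfolding r_def N_def using F by (simp add: pmf_bind_pmf_of_set)
    also have "(\<Sum>u\<in>F. 1 - of_bool (y \<oplus> u \<in> F)) = N - real (card ?P)"
      using F by (simp add: sum_subtractf N_def of_bool_def sum.If_cases Int_def)
    finally show ?thesis using P N by (simp add: pos_le_divide_eq)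
  qed
  have s: "s x \<ge> 12 / 25" if x: "x \<in> H - K" for x
  proof -
    let ?D = "{y. y \<preceq> x}"
    have xc: "x \<in> cube n" using x H' by blast
    have "?D \<inter> H \<subset> ?D" using x by (auto simp: K_def)
    then have "2 * card (?D \<inter> H) \<le> card ?D"
      using xor_subgroup_below[OF xc] H by (intro card_proper_xor_subgroup xor_subgroup_Int)
    moreover have "card ?D = card (?D \<inter> H) + card (?D - H)"
      using finite_below card_Diff_subset_Int[of ?D H]
      by (metis Int_Diff_Un Int_Diff_disjoint card_Un_disjoint finite_Diff finite_Int)
    ultimately have half: "card ?D \<le> 2 * card (?D - H)" by linarith
    have "real (card ?D) * (12 / 25) \<le> (\<Sum>y\<in>?D - H. 24 / 25)" using half by simp
    also have "\<dots> \<le> (\<Sum>y\<in>?D - H. r y)"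
      by (rule sum_mono) (use r below_subset_cube[OF xc] in auto)
    also have "\<dots> \<le> (\<Sum>y\<in>?D. r y)"
      by (rule sum_mono2) (auto simp: finite_below r_def)
    finally have "12 / 25 \<le> (\<Sum>y\<in>?D. r y) / card ?D"
      using card_below_pos[of x] by (simp add: field_simps)
    also have "\<dots> = s x"
      unfolding s_def r_def using below_refl[of x] finite_below[of x]
      by (subst pmf_bind_pmf_of_set) auto
    finally show ?thesis .
  qed
  have "K \<subset> H"
    using downward_closed_xor_subgroup_antimono_conj[OF H] notC by (auto simp: K_def)
  then have "2 * card K \<le> card H"
    using xor_subgroup_downward_core[OF H] H by (intro card_proper_xor_subgroup) (auto simp: K_def)
  moreover have "card (H - K) = card H - card K"
    using \<open>K \<subset> H\<close> H' by (intro card_Diff_subset) (auto intro: finite_subset)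
  moreover have "card K \<le> card H" using \<open>K \<subset> H\<close> H' by (intro card_mono) auto
  ultimately have HK: "card H \<le> 2 * card (H - K)" by linarith
  have "card (H - K) \<le> card ((H - F) \<union> (F \<inter> (H - K)))"
    using F H' by (intro card_mono) auto
  also have "\<dots> \<le> card (H - F) + card (F \<inter> (H - K))" by (rule card_Un_le)
  finally have 1: "real (card (H - K)) \<le> N / 50 + real (card (F \<inter> (H - K)))"
    using HF unfolding F_def N_def by linarith
  have "card F \<le> card ((F - H) \<union> H)" using F H' by (intro card_mono) auto
  also have "\<dots> \<le> card (F - H) + card H" by (rule card_Un_le)
  finally have 2: "N \<le> N / 50 + real (card H)"
    using FH unfolding F_def N_def by linarith
  \<comment> \<open>\<open>H\<close> has at least 49N/50 elements, at least half of them outside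
    \<open>K\<close>, and at most N/50 of these are outside F: 49/100 - 2/100 = 47/100.\<close>
  from 1 2 HK have "N * (47 / 100) \<le> real (card (F \<inter> (H - K)))" by linarith
  then have "N / 5 \<le> (\<Sum>x\<in>F \<inter> (H - K). 12 / 25)" using N by simp
  also have "\<dots> \<le> (\<Sum>x\<in>F \<inter> (H - K). s x)" by (rule sum_mono) (use s in auto)
  also have "\<dots> \<le> (\<Sum>x\<in>F. s x)" by (rule sum_mono2) (auto simp: F s_def)
  finally have "1 / 5 \<le> (\<Sum>x\<in>F. s x) / N" using N by (simp add: field_simps)
  also have "\<dots> = pmf (pass2 n f) False"
    unfolding s_def N_def pass2_def F_def[symmetric] using F by (subst pmf_bind_pmf_of_set) auto
  finally show ?thesis .
qed

section \<open>Soundness of the tester\<close>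

text \<open>The power is at most exp(-2), and exp 2 is at least 1 + 2.\<close>

lemma one_minus_power_le_third:
  fixes p :: real
  assumes "0 \<le> p" "p \<le> 1" "2 \<le> p * real m"
  shows "(1 - p) ^ m \<le> 1 / 3"
proof -
  have "(1 - p) ^ m \<le> exp (- p) ^ m"
    using assms exp_ge_add_one_self[of "- p"] by (intro power_mono) auto
  also have "\<dots> = exp (- (p * real m))" by (simp add: exp_of_nat_mult[symmetric] mult.commute)
  also have "\<dots> \<le> exp (- 2)" using assms by simp
  also have "\<dots> \<le> 1 / 3"
    using exp_ge_add_one_self[of "2::real"] by (simp add: exp_minus field_simps)
  finally show ?thesis .
qed

text \<open>The conjunction of all negated variables has only the zero vector as a one, so the
  symmetric difference has at most \<open>card (ones n f) + 1\<close> elements. This caps \<epsilon>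
  at 2 whenever f is \<epsilon>-far.\<close>

lemma rel_dist_antimono_conj_le_2:
  assumes "ones n f \<noteq> {}"
  obtains g where "g \<in> antimono_conj n" "rel_dist n f g \<le> 2"
proof
  let ?g = "\<lambda>x :: bool list. \<forall>i\<in>{..<n}. \<not> x ! i"
  show "?g \<in> antimono_conj n" unfolding antimono_conj_def by blast
  have "ones n ?g \<subseteq> {replicate n False}"
    by (auto simp: ones_def cube_def intro: nth_equalityI)
  then have "card (ones n f - ones n ?g \<union> (ones n ?g - ones n f)) \<le>
      card (insert (replicate n False) (ones n f))"
    by (intro card_mono) auto
  also have "\<dots> \<le> Suc (card (ones n f))" by (rule card_insert_le_m1) auto
  also have "\<dots> \<le> 2 * card (ones n f)" using assms by (simp add: Suc_le_eq card_gt_0_iff)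
  finally show "rel_dist n f ?g \<le> 2"
    unfolding rel_dist_def using assms by (intro mult_imp_div_pos_le) (auto simp: card_gt_0_iff simp flip: of_nat_mult)
qed

text \<open>The phases split at \<delta> = \<epsilon>/500: from there on, the at least
  1000/\<epsilon> rounds of Phase 1 make (rate times rounds) at least 2; below it, a subgroup close
  to F exists and Phase 2 rejects.\<close>

lemma conj_tester_rejects:
  assumes ne: "ones n f \<noteq> {}" and \<epsilon>: "\<epsilon> > 0" and c1: "c1 \<ge> 1000" and c2: "c2 \<ge> 10"
    and far: "\<forall>g \<in> antimono_conj n. rel_dist n f g \<ge> \<epsilon>"
  shows "pmf (verdict n f (conj_tester c1 c2 \<epsilon>)) True \<le> 1 / 3"
proof -
  let ?F = "ones n f"
  define \<delta> where "\<delta> = pmf (pass1 n f) False"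
  define p where "p = pmf (pass2 n f) False"
  let ?m = "nat \<lceil>c1 / \<epsilon>\<rceil>"
  have T: "pmf (verdict n f (conj_tester c1 c2 \<epsilon>)) True = (1 - \<delta>) ^ ?m * (1 - p) ^ c2"
    by (simp add: verdict_conj_tester \<delta>_def p_def pmf_False_conv_True)
  have \<delta>01: "0 \<le> \<delta>" "\<delta> \<le> 1" and p01: "0 \<le> p" "p \<le> 1" by (simp_all add: \<delta>_def p_def pmf_le_1)
  obtain g where "g \<in> antimono_conj n" "rel_dist n f g \<le> 2"
    using rel_dist_antimono_conj_le_2[OF ne] by blast
  then have \<epsilon>2: "\<epsilon> \<le> 2" using far by (blast intro: order_trans)
  show ?thesis
  proof (cases "\<delta> \<ge> \<epsilon> / 500")
    case True
    have "2 \<le> \<epsilon> / 500 * (c1 / \<epsilon>)" using \<epsilon> c1 by simp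
    also have "\<dots> \<le> \<delta> * real ?m"
      using True \<epsilon> c1 by (intro mult_mono real_nat_ceiling_ge) auto
    finally have "(1 - \<delta>) ^ ?m \<le> 1 / 3" using \<delta>01 by (intro one_minus_power_le_third)
    moreover have "(1 - \<delta>) ^ ?m * (1 - p) ^ c2 \<le> (1 - \<delta>) ^ ?m"
      using \<delta>01 p01 by (intro mult_left_le) (auto intro: power_le_one)
    ultimately show ?thesis using T by linarith
  next
    case False
    \<comment> \<open>This makes \<open>5 * \<delta>\<close> less than 1/50, the closeness that the
      analysis of Phase 2 requires.\<close>
    then have \<delta>: "\<delta> < 1 / 250" using \<epsilon>2 by simp
    have N: "real (card ?F) > 0" using ne by (simp add: card_gt_0_iff)
    have "real (card {(x, y) \<in> ?F \<times> ?F. x \<oplus> y \<notin> ?F}) \<le> \<delta> * (real (card ?F))\<^sup>2"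
      unfolding \<delta>_def pmf_pass1_False[OF ne] using N by simp
    then obtain H where H: "xor_subgroup n H"
      and FH: "real (card (?F - H)) \<le> 5 * \<delta> * real (card ?F)"
      and HF: "real (card (H - ?F)) \<le> 2 * \<delta> * real (card ?F)"
      using near_xor_subgroup[of ?F n \<delta>] \<delta> ne by (auto simp: ones_def)
    \<comment> \<open>Otherwise f would be at relative distance at most 5\<delta> + 2\<delta> <
      \<epsilon> from a conjunction.\<close>
    have "(\<lambda>x. x \<in> H) \<notin> antimono_conj n"
    proof
      assume "(\<lambda>x. x \<in> H) \<in> antimono_conj n"
      then have "\<epsilon> \<le> rel_dist n f (\<lambda>x. x \<in> H)" using far by blast
      also have "ones n (\<lambda>x. x \<in> H) = H" using xor_subgroupD(1)[OF H] by (auto simp: ones_def)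
      then have "rel_dist n f (\<lambda>x. x \<in> H) = real (card ((?F - H) \<union> (H - ?F))) / real (card ?F)"
        by (simp add: rel_dist_def)
      also have "\<dots> \<le> (real (card (?F - H)) + real (card (H - ?F))) / real (card ?F)"
        by (intro divide_right_mono) (auto simp flip: of_nat_add intro: card_Un_le)
      also have "\<dots> \<le> 7 * \<delta>" using FH HF N by (simp add: field_simps)
      finally show False using False \<epsilon> by simp
    qed
    moreover have "\<delta> * real (card ?F) \<le> 1 / 250 * real (card ?F)"
      using \<delta> by (intro mult_right_mono) auto
    ultimately have p: "p \<ge> 1 / 5"
      unfolding p_def using FH HF by (intro pmf_pass2_False[OF H ne]) auto
    have "2 \<le> 1 / 5 * real c2" using c2 by simp
    also have "\<dots> \<le> p * real c2" using p by (intro mult_right_mono) auto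
    finally have "(1 - p) ^ c2 \<le> 1 / 3" using p01 by (intro one_minus_power_le_third)
    moreover have "(1 - \<delta>) ^ ?m * (1 - p) ^ c2 \<le> (1 - p) ^ c2"
      using \<delta>01 p01 by (intro mult_left_le_one_le) (auto intro: power_le_one)
    ultimately show ?thesis using T by linarith
  qed
qed

section \<open>Non-adaptivity and the number of oracle calls\<close>

text \<open>Different answers to a query can only make one copy halt, and a halted algorithm is
  compatible with every other.\<close>

lemma non_adaptive_conj_tester: "non_adaptive (conj_tester c1 c2 \<epsilon>)"
proof -
  have 1: "compatible (phase1_round A) (phase1_round A)" if "compatible A A" for A
    using that unfolding phase1_round_def by (auto intro!: compatible.intros)
  have 2: "compatible (phase2_round A) (phase2_round A)" if "compatible A A" for A
    using that unfolding phase2_round_def by (auto intro!: compatible.intros)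
  have "compatible ((phase1_round ^^ k) A) ((phase1_round ^^ k) A)" if "compatible A A" for k A
    by (induction k) (auto simp: that 1)
  moreover have "compatible ((phase2_round ^^ k) A) ((phase2_round ^^ k) A)" if "compatible A A" for k A
    by (induction k) (auto simp: that 2)
  ultimately show ?thesis
    unfolding non_adaptive_def conj_tester_def by (simp add: compatible.intros)
qed

definition calls_at_most :: "nat \<Rightarrow> (bool list \<Rightarrow> bool) \<Rightarrow> oracle_alg \<Rightarrow> nat \<Rightarrow> bool" where
  "calls_at_most n f A k \<longleftrightarrow> (\<forall>(b, m) \<in> set_pmf (run n f A). m \<le> k)"

text \<open>A round of either phase makes at most two calls to \<open>Samp\<close> and one to
  \<open>MQ\<close>; drawing y in Phase 2 is internal randomness and is not counted.\<close>

lemma calls_at_most_conj_tester: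
  "calls_at_most n f (conj_tester c1 c2 \<epsilon>) (3 * nat \<lceil>c1 / \<epsilon>\<rceil> + 3 * c2)"
proof -
  have 1: "calls_at_most n f (phase1_round A) (3 + k)" if "calls_at_most n f A k" for A k
    using that unfolding calls_at_most_def phase1_round_def by (fastforce split: if_splits)
  have 2: "calls_at_most n f (phase2_round A) (3 + k)" if "calls_at_most n f A k" for A k
    using that unfolding calls_at_most_def phase2_round_def by (fastforce split: if_splits)
  have "calls_at_most n f ((phase1_round ^^ j) A) (3 * j + k)" if "calls_at_most n f A k" for j k A
  proof (induction j)
    case (Suc j)
    then show ?case using 1[OF Suc] by (simp add: algebra_simps)
  qed (use that in simp)
  moreover have "calls_at_most n f ((phase2_round ^^ j) (Halt True)) (3 * j)" for j
  proof (induction j)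
    case (Suc j)
    then show ?case using 2[OF Suc] by (simp add: algebra_simps)
  qed (simp add: calls_at_most_def)
  ultimately show ?thesis by (simp add: conj_tester_def)
qed

theorem theorem3p7:
  "\<exists>(K1::real) (K2::nat). \<forall>c1 \<ge> K1. \<forall>c2 \<ge> K2.
     (\<forall>(n::nat) (\<epsilon>::real). \<epsilon> > 0 \<longrightarrow>
        rel_error_tester n (antimono_conj n) \<epsilon> (conj_tester c1 c2 \<epsilon>) \<and>
        one_sided n (antimono_conj n) (conj_tester c1 c2 \<epsilon>) \<and>
        non_adaptive (conj_tester c1 c2 \<epsilon>)) \<and>
     (\<exists>C::real. \<forall>(n::nat) (\<epsilon>::real) f. \<epsilon> > 0 \<longrightarrow> ones n f \<noteq> {} \<longrightarrow>
        (\<forall>(b, m) \<in> set_pmf (run n f (conj_tester c1 c2 \<epsilon>)). real m \<le> C * max 1 (1 / \<epsilon>)))"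
proof (rule exI[of _ "1000::real"], rule exI[of _ "10::nat"], intro allI impI conjI)
  fix c1 :: real and c2 n :: nat and \<epsilon> :: real
  assume c: "c1 \<ge> 1000" "c2 \<ge> 10" and \<epsilon>: "\<epsilon> > 0"
  have complete: "pmf (verdict n f (conj_tester c1 c2 \<epsilon>)) True = 1"
    if "f \<in> antimono_conj n" "ones n f \<noteq> {}" for f
    by (simp add: verdict_conj_tester pass_antimono_conj[OF that])
  show "one_sided n (antimono_conj n) (conj_tester c1 c2 \<epsilon>)"
    using complete by (simp add: one_sided_def)
  show "rel_error_tester n (antimono_conj n) \<epsilon> (conj_tester c1 c2 \<epsilon>)"
    unfolding rel_error_tester_def
    using complete conj_tester_rejects[OF _ \<epsilon> c] by (fastforce simp: pmf_False_conv_True)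
  show "non_adaptive (conj_tester c1 c2 \<epsilon>)" by (rule non_adaptive_conj_tester)
next
  fix c1 :: real and c2 :: nat
  assume c: "c1 \<ge> 1000" "c2 \<ge> 10"
  \<comment> \<open>The middle 3 pays for one extra round of Phase 1 from rounding up. The terms
    independent of \<epsilon> are absorbed by \<open>max 1 (1 / \<epsilon>)\<close>, also when
    \<epsilon> exceeds 1.\<close>
  define C where "C = 3 * c1 + 3 + 3 * real c2"
  show "\<exists>C::real. \<forall>(n::nat) (\<epsilon>::real) f. \<epsilon> > 0 \<longrightarrow> ones n f \<noteq> {} \<longrightarrow>
        (\<forall>(b, m) \<in> set_pmf (run n f (conj_tester c1 c2 \<epsilon>)). real m \<le> C * max 1 (1 / \<epsilon>))"
  proof (intro exI[of _ C] allI impI ballI, clarify)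
    fix n f b m and \<epsilon> :: real
    assume \<epsilon>: "\<epsilon> > 0" and m: "(b, m) \<in> set_pmf (run n f (conj_tester c1 c2 \<epsilon>))"
    let ?M = "max 1 (1 / \<epsilon>)"
    have "m \<le> 3 * nat \<lceil>c1 / \<epsilon>\<rceil> + 3 * c2"
      using calls_at_most_conj_tester[of n f c1 c2 \<epsilon>] m by (auto simp: calls_at_most_def)
    then have "real m \<le> 3 * real (nat \<lceil>c1 / \<epsilon>\<rceil>) + 3 * real c2" by linarith
    also have "real (nat \<lceil>c1 / \<epsilon>\<rceil>) \<le> c1 / \<epsilon> + 1" using \<epsilon> c by (simp add: of_nat_ceiling)
    also have "c1 / \<epsilon> \<le> c1 * ?M"
      using c mult_left_mono[of "1 / \<epsilon>" ?M c1] by simp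
    also have "3 * (c1 * ?M + 1) + 3 * real c2 \<le> C * ?M"
      using mult_left_mono[of 1 ?M "3 + 3 * real c2"] by (simp add: C_def algebra_simps)
    finally show "real m \<le> C * ?M" by simp
  qed
qed

end
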